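(* Let $A$ be a bounded linear operator in a Hilbert space $H$ with null space $N$, let $f=Ay$ with $y\perp N$, and let $C\in(1,2)$ and $b>0$ be constants with $C^2>1+b$. For each $\delta\in(0,\delta_0)$, where $\delta_0>0$, let $f_\delta\in H$ satisfy $\|f_\delta-f\|\le\delta$ and $\|f_\delta\|>C\delta$. For $a>0$ put $$F(u)=F_{a,\delta}(u)=\|Au-f_\delta\|^2+a\|u\|^2,\qquad m=m(\delta,a)=\inf_{u\in H}F(u),$$ and let $u_{a,\delta}\in H$ be any element, depending continuously on $a\in(0,\infty)$ for each fixed $\delta$, which satisfies $$F(u_{a,\delta})\le m+(C^2-1-b)\delta^2 .$$ Then for any fixed $\delta\in(0,\delta_0)$ the equation $$\|Au_{a,\delta}-f_\delta\|=C\delta$$ has a solution $a=a(\delta)>0$, with $\lim_{\delta\to0}a(\delta)=0$, and $$\lim_{\delta\to0}\|u_\delta-y\|=0,\qquad\text{where } u_\delta=u_{a(\delta),\delta}.$$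
   Context: $N=N(A)=\{u\in H: Au=0\}$ is the null space of $A$. The equation $\|Au_{a,\delta}-f_\delta\|=C\delta$ is an equation for $a\in(0,\infty)$. *)

theory Defs
  imports "HOL-Analysis.Analysis"
begin

text \<open>
  Hilbert spaces are rendered by the sort \<open>{real_inner, complete_space}\<close>. This also covers complex
  Hilbert spaces, regarded as real ones with inner product \<open>Re \<langle>x, y\<rangle>\<close>: norm, completeness,
  boundedness of \<open>A\<close> and null space are unchanged, and for a complex subspace \<open>N\<close> one has
  \<open>y \<bottom> N\<close> for \<open>\<langle>_, _\<rangle>\<close> iff \<open>y \<bottom> N\<close> for \<open>Re \<langle>_, _\<rangle>\<close> (replace \<open>z \<in> N\<close> by \<open>\<i> z \<in> N\<close>).
\<close>

definition null_space :: "('a::real_vector \<Rightarrow> 'a) \<Rightarrow> 'a set" where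
  "null_space A = {u. A u = 0}"

definition F_functional ::
    "('a::real_normed_vector \<Rightarrow> 'a) \<Rightarrow> 'a \<Rightarrow> real \<Rightarrow> 'a \<Rightarrow> real" where
  "F_functional A g a u = (norm (A u - g))\<^sup>2 + a * (norm u)\<^sup>2"

text \<open>For \<open>a > 0\<close> the functional is bounded below by \<open>0\<close>, so this real infimum is the actual one.\<close>

definition F_inf :: "('a::real_normed_vector \<Rightarrow> 'a) \<Rightarrow> 'a \<Rightarrow> real \<Rightarrow> real" where
  "F_inf A g a = (INF u. F_functional A g a u)"

end

theory Submission
  imports Defs
begin

text \<open>
  Everything follows from comparing \<open>u\<^sub>a = u a \<delta>\<close> with suitable competitors \<open>v\<close> in
  \<open>F(u\<^sub>a) \<le> F(v) + (C\<^sup>2 - 1 - b) \<delta>\<^sup>2\<close>.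

  The competitor \<open>v = y\<close> gives \<open>F(u\<^sub>a) \<le> (C\<^sup>2 - b) \<delta>\<^sup>2 + a \<parallel>y\<parallel>\<^sup>2\<close>, so the residual drops below
  \<open>C \<delta>\<close> as \<open>a \<rightarrow> 0\<close>; the competitor \<open>v = 0\<close> bounds \<open>a \<parallel>u\<^sub>a\<parallel>\<^sup>2\<close>, so \<open>u\<^sub>a \<rightarrow> 0\<close> and the residual tends
  to \<open>\<parallel>f\<delta>\<parallel> > C \<delta>\<close> as \<open>a \<rightarrow> \<infinity>\<close>. The intermediate value theorem yields a solution
  (\<open>discrepancy_equation_solvable\<close>).

  At a solution, the first comparison reads \<open>C\<^sup>2 \<delta>\<^sup>2 + a \<parallel>u\<^sub>a\<parallel>\<^sup>2 \<le> (C\<^sup>2 - b) \<delta>\<^sup>2 + a \<parallel>y\<parallel>\<^sup>2\<close>, whence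
  \<open>\<parallel>u\<^sub>a\<parallel> \<le> \<parallel>y\<parallel>\<close>, while the discrepancy equation forces \<open>A u\<^sub>a \<rightarrow> A y\<close> as \<open>\<delta> \<rightarrow> 0\<close>. Being orthogonal to
  the null space, \<open>y\<close> is the solution of minimal norm, so these two facts alone imply norm convergence
  (\<open>tendsto_minimal_norm_solution\<close>). The usual argument takes a weak limit; here weak compactness
  is replaced by the parallelogram law and one Cauchy sequence
  (\<open>norm_lower_bound_near_minimal_norm_solution\<close>).

  Finally, \<open>a(\<delta>)\<close> is bounded by comparing \<open>u\<^sub>a\<close> with its own multiple \<open>(1 - \<delta>) u\<^sub>a\<close>: shrinking saves
  about \<open>2 \<delta> a \<parallel>u\<^sub>a\<parallel>\<^sup>2\<close> in the penalty and leaves a residual of order \<open>\<delta>\<close>, so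
  \<open>a \<parallel>u\<^sub>a\<parallel>\<^sup>2 = O(\<delta>)\<close>. Now \<open>\<parallel>u\<^sub>a\<parallel> \<rightarrow> \<parallel>y\<parallel>\<close>, and \<open>y \<noteq> 0\<close> because the data \<open>f\<delta>\<close> exceed the noise level; hence
  \<open>a(\<delta>) \<rightarrow> 0\<close>.
\<close>

section \<open>Convergence to the minimal-norm solution\<close>

lemma parallelogram_bound:
  fixes x z :: "'a::real_inner"
  assumes "c \<le> (norm ((1/2) *\<^sub>R (x + z)))\<^sup>2"
  shows "(norm (x - z))\<^sup>2 \<le> 2 * (norm x)\<^sup>2 + 2 * (norm z)\<^sup>2 - 4 * c"
proof -
  have "(norm ((1/2) *\<^sub>R (x + z)))\<^sup>2 = (norm (x + z))\<^sup>2 / 4"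
    by (simp add: power_divide)
  moreover have "(norm (x - z))\<^sup>2 + (norm (x + z))\<^sup>2 = 2 * (norm x)\<^sup>2 + 2 * (norm z)\<^sup>2"
    by (simp add: power2_norm_eq_inner inner_add inner_diff inner_commute)
  ultimately show ?thesis using assms by simp
qed

lemma norm_midpoint_residual_le:
  fixes A :: "'a::real_normed_vector \<Rightarrow> 'b::real_normed_vector"
  assumes A: "bounded_linear A" and "norm (A x - g) \<le> e" "norm (A z - g) \<le> e"
  shows "norm (A ((1/2) *\<^sub>R (x + z)) - g) \<le> e"
proof -
  interpret bounded_linear A by (rule A)
  have "A ((1/2) *\<^sub>R (x + z)) - g = (1/2) *\<^sub>R ((A x - g) + (A z - g))"
    using scaleR_half_double [of g] by (simp add: scaleR add algebra_simps)
  also have "norm \<dots> \<le> (1/2) * (norm (A x - g) + norm (A z - g))"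
    by (simp add: norm_triangle_ineq)
  also have "\<dots> \<le> e" using assms(2,3) by simp
  finally show ?thesis .
qed

text \<open>
  This is the substitute for weak lower semicontinuity of the norm. The minimal norms over the convex
  sets \<open>K n\<close> increase to some \<open>D\<close>; by the parallelogram law near-minimizers form a Cauchy
  sequence, whose limit solves \<open>A w = A y\<close> with \<open>\<parallel>w\<parallel>\<^sup>2 = D\<close>. By Pythagoras no solution is shorter
  than \<open>y\<close>, so \<open>D \<ge> \<parallel>y\<parallel>\<^sup>2\<close>.
\<close>

lemma norm_lower_bound_near_minimal_norm_solution:
  fixes A :: "'a::{real_inner, complete_space} \<Rightarrow> 'b::real_normed_vector"
  assumes A: "bounded_linear A" and y: "y \<in> orthogonal_comp {x. A x = 0}" and "e > 0"
  shows "\<exists>r>0. \<forall>x. norm (A x - A y) \<le> r \<longrightarrow> (norm y)\<^sup>2 - e < (norm x)\<^sup>2"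
proof -
  interpret bounded_linear A by (rule A)
  define K where "K n = {x. norm (A x - A y) \<le> 1 / Suc n}" for n
  define d where "d n = (INF x\<in>K n. (norm x)\<^sup>2)" for n
  have yK: "y \<in> K n" for n by (simp add: K_def)
  have bdd: "bdd_below ((\<lambda>x. (norm x)\<^sup>2) ` K n)" for n
    by (rule bdd_belowI2 [of _ 0]) simp
  have d_le: "d n \<le> (norm x)\<^sup>2" if "x \<in> K n" for n x
    unfolding d_def by (rule cINF_lower [OF bdd that])
  have K_anti: "K m \<subseteq> K n" if "n \<le> m" for m n
  proof -
    have "1 / real (Suc m) \<le> 1 / Suc n" using that by (simp add: frac_le)
    then show ?thesis by (force simp: K_def)
  qed
  have "incseq d"
  proof (rule incseq_SucI)
    fix n show "d n \<le> d (Suc n)"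
      unfolding d_def
      by (rule cINF_superset_mono) (use yK bdd K_anti [of n "Suc n"] in auto)
  qed
  then obtain D where D: "d \<longlonglongrightarrow> D" and dD: "\<And>n. d n \<le> D"
    using incseq_convergent [of d "(norm y)\<^sup>2"] d_le [OF yK] by auto
  have "\<exists>x\<in>K n. (norm x)\<^sup>2 < d n + 1 / Suc n" for n
    using cINF_less_iff [OF _ bdd, of n "d n + 1 / Suc n"] yK [of n] by (auto simp: d_def)
  then obtain v where vK: "\<And>n. v n \<in> K n" and v: "\<And>n. (norm (v n))\<^sup>2 < d n + 1 / Suc n"
    by metis
  have v_diff: "(norm (v m - v n))\<^sup>2 \<le> 4 * (D - d N) + 4 / Suc N" if "N \<le> m" "N \<le> n" for m n N
  proof -
    have mK: "v m \<in> K N" and nK: "v n \<in> K N" using vK K_anti that by blast+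
    then have "(1/2) *\<^sub>R (v m + v n) \<in> K N"
      unfolding K_def using norm_midpoint_residual_le [OF A] by blast
    from parallelogram_bound [OF d_le [OF this]]
    have "(norm (v m - v n))\<^sup>2 \<le> 2 * (norm (v m))\<^sup>2 + 2 * (norm (v n))\<^sup>2 - 4 * d N" .
    moreover have "(norm (v k))\<^sup>2 \<le> D + 1 / Suc N" if "N \<le> k" for k
    proof -
      have "1 / real (Suc k) \<le> 1 / Suc N" using that by (simp add: frac_le)
      then show ?thesis using v [of k] dD [of k] by linarith
    qed
    ultimately show ?thesis using that by (smt (verit) add_divide_distrib)
  qed
  have lim_inv: "(\<lambda>n. 1 / real (Suc n)) \<longlonglongrightarrow> 0"
    using LIMSEQ_inverse_real_of_nat by (simp add: divide_inverse)
  have "Cauchy v"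
  proof (rule metric_CauchyI)
    fix s :: real assume "s > 0"
    have "(\<lambda>N. 4 * (D - d N) + 4 * (1 / Suc N)) \<longlonglongrightarrow> 4 * (D - D) + 4 * 0"
      by (intro tendsto_intros D lim_inv)
    then have "\<forall>\<^sub>F N in sequentially. 4 * (D - d N) + 4 * (1 / Suc N) < s\<^sup>2"
      by (rule order_tendstoD) (use \<open>s > 0\<close> in simp)
    then obtain N where N: "4 * (D - d N) + 4 / Suc N < s\<^sup>2"
      by (auto simp: eventually_sequentially)
    have "dist (v m) (v n) < s" if "N \<le> m" "N \<le> n" for m n
      using v_diff [OF that] N \<open>s > 0\<close> unfolding dist_norm
      by (intro power2_less_imp_less [of _ s]) auto
    then show "\<exists>M. \<forall>m\<ge>M. \<forall>n\<ge>M. dist (v m) (v n) < s" by blast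
  qed
  then obtain w where w: "v \<longlonglongrightarrow> w" using Cauchy_convergent convergent_def by blast
  have "(\<lambda>n. A (v n) - A y) \<longlonglongrightarrow> 0"
    by (rule tendsto_norm_zero_cancel, rule tendsto_sandwich [OF _ _ tendsto_const lim_inv])
       (use vK in \<open>auto simp: K_def\<close>)
  then have "(\<lambda>n. A (v n)) \<longlonglongrightarrow> A y" by (rule LIM_zero_cancel)
  moreover have "(\<lambda>n. A (v n)) \<longlonglongrightarrow> A w" by (rule tendsto [OF w])
  ultimately have "A w = A y" using LIMSEQ_unique by blast
  then have "orthogonal (w - y) y"
    using y by (simp add: orthogonal_comp_def diff)
  then have "(norm w)\<^sup>2 = (norm (w - y))\<^sup>2 + (norm y)\<^sup>2"
    using norm_add_Pythagorean by fastforce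
  moreover have "(norm w)\<^sup>2 \<le> D"
  proof (rule LIMSEQ_le)
    show "(\<lambda>n. (norm (v n))\<^sup>2) \<longlonglongrightarrow> (norm w)\<^sup>2" by (intro tendsto_intros w)
    show "(\<lambda>n. d n + 1 / Suc n) \<longlonglongrightarrow> D" using tendsto_add [OF D lim_inv] by simp
  qed (use v less_imp_le in blast)
  ultimately have "(norm y)\<^sup>2 - e < D" using \<open>e > 0\<close> by (smt (verit) zero_le_power2)
  then obtain n where "(norm y)\<^sup>2 - e < d n"
    using order_tendstoD(1) [OF D] by (metis eventually_sequentially order_refl)
  then have "\<forall>x. norm (A x - A y) \<le> 1 / Suc n \<longrightarrow> (norm y)\<^sup>2 - e < (norm x)\<^sup>2"
    using d_le by (fastforce simp: K_def)
  then show ?thesis by (intro exI [of _ "1 / Suc n"]) simp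
qed

text \<open>
  If \<open>\<parallel>x\<parallel> \<le> \<parallel>y\<parallel>\<close> and \<open>A x\<close> is close to \<open>A y\<close>, then the midpoint of \<open>x\<close> and \<open>y\<close> also nearly solves the
  equation, hence is hardly shorter than \<open>y\<close>; uniform convexity then brings \<open>x\<close> close to \<open>y\<close>.
\<close>

lemma tendsto_minimal_norm_solution:
  fixes A :: "'a::{real_inner, complete_space} \<Rightarrow> 'b::real_normed_vector"
  assumes A: "bounded_linear A" and y: "y \<in> orthogonal_comp {x. A x = 0}"
    and lim: "((\<lambda>i. A (v i)) \<longlongrightarrow> A y) F"
    and le: "\<forall>\<^sub>F i in F. norm (v i) \<le> norm y"
  shows "(v \<longlongrightarrow> y) F"
proof (rule tendstoI)
  fix s :: real assume s: "s > 0"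
  then obtain r where "r > 0"
    and r: "\<And>x. norm (A x - A y) \<le> r \<Longrightarrow> (norm y)\<^sup>2 - s\<^sup>2 / 4 < (norm x)\<^sup>2"
    using norm_lower_bound_near_minimal_norm_solution [OF A y, of "s\<^sup>2 / 4"] by auto
  show "\<forall>\<^sub>F i in F. dist (v i) y < s"
    using tendstoD [OF lim \<open>r > 0\<close>] le
  proof eventually_elim
    case (elim i)
    define z where "z = (1/2) *\<^sub>R (v i + y)"
    have "norm (A z - A y) \<le> r"
      unfolding z_def using elim \<open>r > 0\<close>
      by (intro norm_midpoint_residual_le [OF A]) (auto simp: dist_norm)
    then have "(norm y)\<^sup>2 - s\<^sup>2 / 4 < (norm z)\<^sup>2" by (rule r)
    moreover have "(norm (v i - y))\<^sup>2 \<le> 2 * (norm (v i))\<^sup>2 + 2 * (norm y)\<^sup>2 - 4 * (norm z)\<^sup>2"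
      unfolding z_def by (rule parallelogram_bound) simp
    moreover have "(norm (v i))\<^sup>2 \<le> (norm y)\<^sup>2" using elim by (simp add: power_mono)
    ultimately have "(norm (v i - y))\<^sup>2 < s\<^sup>2" by linarith
    then show ?case using s by (simp add: dist_norm power_less_imp_less_base)
  qed
qed

section \<open>Near-minimizers of the Tikhonov functional\<close>

lemma F_functional_le_if_near_inf:
  assumes "a > 0" and "F_functional A g a x \<le> F_inf A g a + k"
  shows "F_functional A g a x \<le> F_functional A g a v + k"
proof -
  have "bdd_below (range (F_functional A g a))"
    by (rule bdd_belowI2 [of _ 0]) (use \<open>a > 0\<close> in \<open>simp add: F_functional_def\<close>)
  then have "F_inf A g a \<le> F_functional A g a v"
    unfolding F_inf_def by (rule cINF_lower) simp
  then show ?thesis using assms(2) by linarith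
qed

lemma F_functional_le_exact_solution:
  assumes "a > 0" and "norm (g - A y) \<le> \<delta>"
    and "F_functional A g a x \<le> F_inf A g a + (C\<^sup>2 - 1 - b) * \<delta>\<^sup>2"
  shows "F_functional A g a x \<le> (C\<^sup>2 - b) * \<delta>\<^sup>2 + a * (norm y)\<^sup>2"
proof -
  have "(norm (A y - g))\<^sup>2 \<le> \<delta>\<^sup>2"
    using assms(2) by (simp add: norm_minus_commute power_mono)
  then show ?thesis
    using F_functional_le_if_near_inf [OF assms(1,3), of y]
    by (simp add: F_functional_def algebra_simps)
qed

text \<open>
  The residual of \<open>(1 - \<delta>) x\<close> is \<open>(1 - \<delta>) (A x - g) - \<delta> g\<close>, of norm at most \<open>\<delta> (C + \<parallel>g\<parallel>)\<close>; the slack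
  \<open>k\<close> is absorbed by the squared residual \<open>C\<^sup>2 \<delta>\<^sup>2\<close> of \<open>x\<close> itself.
\<close>

lemma penalty_bound_by_shrinking:
  assumes A: "bounded_linear A" and "a > 0" and \<delta>: "0 < \<delta>" "\<delta> < 1"
    and res: "norm (A x - g) = C * \<delta>"
    and near: "F_functional A g a x \<le> F_inf A g a + k" and k: "k \<le> C\<^sup>2 * \<delta>\<^sup>2"
  shows "a * (norm x)\<^sup>2 \<le> \<delta> * (C + norm g)\<^sup>2"
proof -
  interpret bounded_linear A by (rule A)
  have "A ((1 - \<delta>) *\<^sub>R x) - g = (1 - \<delta>) *\<^sub>R (A x - g) - \<delta> *\<^sub>R g"
    by (simp add: scaleR diff scaleR_diff_right scaleR_diff_left del: scaleR_collapse)
  also have "norm \<dots> \<le> (1 - \<delta>) * norm (A x - g) + \<delta> * norm g"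
    using norm_triangle_ineq4 [of "(1 - \<delta>) *\<^sub>R (A x - g)" "\<delta> *\<^sub>R g"] \<delta> by simp
  also have "\<dots> \<le> norm (A x - g) + \<delta> * norm g"
    using \<delta> by (simp add: mult_left_le_one_le)
  also have "\<dots> = \<delta> * (C + norm g)" by (simp add: res algebra_simps)
  finally have "(norm (A ((1 - \<delta>) *\<^sub>R x) - g))\<^sup>2 \<le> \<delta>\<^sup>2 * (C + norm g)\<^sup>2"
    by (metis norm_ge_zero power_mono power_mult_distrib)
  moreover have "(norm ((1 - \<delta>) *\<^sub>R x))\<^sup>2 = (1 - \<delta>)\<^sup>2 * (norm x)\<^sup>2"
    by (simp add: power_mult_distrib)
  ultimately have "C\<^sup>2 * \<delta>\<^sup>2 + a * (norm x)\<^sup>2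
      \<le> \<delta>\<^sup>2 * (C + norm g)\<^sup>2 + a * ((1 - \<delta>)\<^sup>2 * (norm x)\<^sup>2) + k"
    using F_functional_le_if_near_inf [OF \<open>a > 0\<close> near, of "(1 - \<delta>) *\<^sub>R x"]
    by (simp add: F_functional_def res power_mult_distrib)
  then have "\<delta> * ((2 - \<delta>) * (a * (norm x)\<^sup>2)) \<le> \<delta> * (\<delta> * (C + norm g)\<^sup>2)"
    using k by (simp add: power2_eq_square algebra_simps)
  then have "(2 - \<delta>) * (a * (norm x)\<^sup>2) \<le> \<delta> * (C + norm g)\<^sup>2"
    using \<delta> by simp
  moreover have "1 * (a * (norm x)\<^sup>2) \<le> (2 - \<delta>) * (a * (norm x)\<^sup>2)"
    using \<delta> \<open>a > 0\<close> by (intro mult_right_mono) auto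
  ultimately show ?thesis by simp
qed

section \<open>Solvability of the discrepancy equation\<close>

lemma discrepancy_equation_solvable:
  fixes A :: "'a::real_normed_vector \<Rightarrow> 'a" and v :: "real \<Rightarrow> 'a"
  assumes A: "bounded_linear A" and "\<delta> > 0" "b > 0" "C > 0"
    and g: "norm (g - A y) \<le> \<delta>" "C * \<delta> < norm g"
    and cont: "continuous_on {0<..} v"
    and near: "\<And>a. a > 0 \<Longrightarrow>
      F_functional A g a (v a) \<le> F_inf A g a + (C\<^sup>2 - 1 - b) * \<delta>\<^sup>2"
  shows "\<exists>a>0. norm (A (v a) - g) = C * \<delta>"
proof -
  interpret bounded_linear A by (rule A)
  define p where "p a = norm (A (v a) - g)" for a
  have cont_p: "continuous_on {0<..} p"
    unfolding p_def by (intro continuous_on_norm continuous_on_diff continuous_on_const continuous_on [OF cont])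
  \<comment> \<open>Any \<open>lo > 0\<close> with \<open>lo \<parallel>y\<parallel>\<^sup>2 < b \<delta>\<^sup>2\<close> would do; the \<open>+ 1\<close> covers \<open>y = 0\<close>.\<close>
  define lo where "lo = b * \<delta>\<^sup>2 / ((norm y)\<^sup>2 + 1)"
  have "lo > 0" using assms by (simp add: lo_def add_nonneg_pos)
  have "lo * ((norm y)\<^sup>2 + 1) = b * \<delta>\<^sup>2"
    by (simp add: lo_def add_nonneg_eq_0_iff)
  then have "(C\<^sup>2 - b) * \<delta>\<^sup>2 + lo * (norm y)\<^sup>2 < (C * \<delta>)\<^sup>2"
    using \<open>lo > 0\<close> by (simp add: algebra_simps)
  moreover have "(p lo)\<^sup>2 \<le> F_functional A g lo (v lo)"
    using \<open>lo > 0\<close> by (simp add: p_def F_functional_def)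
  ultimately have "(p lo)\<^sup>2 \<le> (C * \<delta>)\<^sup>2"
    using F_functional_le_exact_solution [OF \<open>lo > 0\<close> g(1) near [OF \<open>lo > 0\<close>]] by linarith
  then have p_lo: "p lo \<le> C * \<delta>"
    by (rule power2_le_imp_le) (use assms in simp)
  define M where "M = (norm g)\<^sup>2 + (C\<^sup>2 - 1 - b) * \<delta>\<^sup>2"
  have v_le: "(norm (v a))\<^sup>2 \<le> M / a" if "a > 0" for a
  proof -
    have "a * (norm (v a))\<^sup>2 \<le> F_functional A g a (v a)" by (simp add: F_functional_def)
    also have "\<dots> \<le> F_functional A g a 0 + (C\<^sup>2 - 1 - b) * \<delta>\<^sup>2"
      by (rule F_functional_le_if_near_inf [OF that near [OF that]])
    also have "\<dots> = M" by (simp add: F_functional_def M_def zero)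
    finally show ?thesis using that by (simp add: field_simps)
  qed
  have "((\<lambda>a. (norm (v a))\<^sup>2) \<longlongrightarrow> 0) at_top"
  proof (rule tendsto_sandwich [OF _ _ tendsto_const])
    show "\<forall>\<^sub>F a in at_top. (norm (v a))\<^sup>2 \<le> M / a"
      using eventually_gt_at_top [of 0] by eventually_elim (rule v_le)
    show "((\<lambda>a. M / a) \<longlongrightarrow> 0) at_top"
      by (rule tendsto_divide_0 [OF tendsto_const]) (simp add: filterlim_at_top_imp_at_infinity filterlim_ident)
  qed simp
  then have "((\<lambda>a. sqrt ((norm (v a))\<^sup>2)) \<longlongrightarrow> sqrt 0) at_top" by (rule tendsto_real_sqrt)
  then have "(v \<longlongrightarrow> 0) at_top" by (simp add: tendsto_norm_zero_iff)
  then have "(p \<longlongrightarrow> norm (A 0 - g)) at_top"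
    unfolding p_def by (intro tendsto_norm tendsto_diff tendsto_const tendsto [of v])
  then have "\<forall>\<^sub>F a in at_top. C * \<delta> < p a"
    by (rule order_tendstoD) (use g zero in simp)
  then have "\<forall>\<^sub>F a in at_top. C * \<delta> < p a \<and> lo \<le> a"
    using eventually_ge_at_top eventually_conj by blast
  then obtain hi where hi: "C * \<delta> < p hi" "lo \<le> hi"
    using eventually_happens' [OF trivial_limit_at_top_linorder] by blast
  have "continuous_on {lo..hi} p"
    by (rule continuous_on_subset [OF cont_p]) (use \<open>lo > 0\<close> in auto)
  then obtain a where "lo \<le> a" "p a = C * \<delta>"
    using IVT' [of p lo "C * \<delta>" hi] p_lo hi by auto
  then have "a > 0" "norm (A (v a) - g) = C * \<delta>" using \<open>lo > 0\<close> by (auto simp: p_def)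
  then show ?thesis by blast
qed

section \<open>Convergence of the discrepancy principle\<close>

theorem theorem7:
  fixes A :: "'a::{real_inner, complete_space} \<Rightarrow> 'a"
    and f y :: 'a
    and C b \<delta>0 :: real
    and f\<delta> :: "real \<Rightarrow> 'a"
    and u :: "real \<Rightarrow> real \<Rightarrow> 'a"
  assumes "bounded_linear A"
    and "f = A y"
    and "y \<in> orthogonal_comp (null_space A)"
    and "1 < C" "C < 2" "b > 0" "C\<^sup>2 > 1 + b"
    and "\<delta>0 > 0"
    and "\<And>\<delta>. \<delta> \<in> {0<..<\<delta>0} \<Longrightarrow> norm (f\<delta> \<delta> - f) \<le> \<delta>"
    and "\<And>\<delta>. \<delta> \<in> {0<..<\<delta>0} \<Longrightarrow> norm (f\<delta> \<delta>) > C * \<delta>"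
    and "\<And>\<delta>. \<delta> \<in> {0<..<\<delta>0} \<Longrightarrow> continuous_on {0<..} (\<lambda>a. u a \<delta>)"
    and "\<And>a \<delta>. a > 0 \<Longrightarrow> \<delta> \<in> {0<..<\<delta>0} \<Longrightarrow>
           F_functional A (f\<delta> \<delta>) a (u a \<delta>) \<le> F_inf A (f\<delta> \<delta>) a + (C\<^sup>2 - 1 - b) * \<delta>\<^sup>2"
  shows "(\<forall>\<delta>\<in>{0<..<\<delta>0}. \<exists>a>0. norm (A (u a \<delta>) - f\<delta> \<delta>) = C * \<delta>) \<and>
    (\<forall>\<alpha> :: real \<Rightarrow> real.
       (\<forall>\<delta>\<in>{0<..<\<delta>0}. \<alpha> \<delta> > 0 \<and> norm (A (u (\<alpha> \<delta>) \<delta>) - f\<delta> \<delta>) = C * \<delta>) \<longrightarrow>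
       (\<alpha> \<longlongrightarrow> 0) (at_right 0) \<and>
       ((\<lambda>\<delta>. norm (u (\<alpha> \<delta>) \<delta> - y)) \<longlongrightarrow> 0) (at_right 0))"
proof (intro conjI ballI allI impI)
  note A = assms(1) and noise = assms(9)[unfolded assms(2)] and near = assms(12)
  show "\<exists>a>0. norm (A (u a \<delta>) - f\<delta> \<delta>) = C * \<delta>" if "\<delta> \<in> {0<..<\<delta>0}" for \<delta>
    using assms(4,6) noise assms(10-12) that
    by (intro discrepancy_equation_solvable [OF A, where y = y and b = b]) auto
  fix \<alpha> :: "real \<Rightarrow> real"
  assume \<alpha>: "\<forall>\<delta>\<in>{0<..<\<delta>0}. \<alpha> \<delta> > 0 \<and> norm (A (u (\<alpha> \<delta>) \<delta>) - f\<delta> \<delta>) = C * \<delta>"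
  define v where "v \<delta> = u (\<alpha> \<delta>) \<delta>" for \<delta>
  have pos: "\<alpha> \<delta> > 0" and res: "norm (A (v \<delta>) - f\<delta> \<delta>) = C * \<delta>" if "\<delta> \<in> {0<..<\<delta>0}" for \<delta>
    using \<alpha> that by (auto simp: v_def)
  have near_v: "F_functional A (f\<delta> \<delta>) (\<alpha> \<delta>) (v \<delta>)
      \<le> F_inf A (f\<delta> \<delta>) (\<alpha> \<delta>) + (C\<^sup>2 - 1 - b) * \<delta>\<^sup>2" if "\<delta> \<in> {0<..<\<delta>0}" for \<delta>
    unfolding v_def by (rule near [OF pos [OF that] that])
  have small: "\<forall>\<^sub>F \<delta> in at_right 0. \<delta> \<in> {0<..<r}" if "r > 0" for r :: real
    using eventually_at_right_real [OF that] .
  have id0: "((\<lambda>\<delta>. \<delta>) \<longlongrightarrow> (0::real)) (at_right 0)" by (rule tendsto_ident_at)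
  have v_le: "norm (v \<delta>) \<le> norm y" if "\<delta> \<in> {0<..<\<delta>0}" for \<delta>
  proof -
    have "C\<^sup>2 * \<delta>\<^sup>2 + \<alpha> \<delta> * (norm (v \<delta>))\<^sup>2 \<le> (C\<^sup>2 - b) * \<delta>\<^sup>2 + \<alpha> \<delta> * (norm y)\<^sup>2"
      using F_functional_le_exact_solution [OF pos [OF that] noise [OF that] near_v [OF that]]
      by (simp add: F_functional_def res [OF that] power_mult_distrib)
    moreover have "b * \<delta>\<^sup>2 \<ge> 0" using assms(6) by simp
    ultimately have "\<alpha> \<delta> * (norm (v \<delta>))\<^sup>2 \<le> \<alpha> \<delta> * (norm y)\<^sup>2"
      by (simp add: algebra_simps)
    then show ?thesis using pos [OF that] by (simp add: power2_le_iff_abs_le)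
  qed
  have data_lim: "(f\<delta> \<longlongrightarrow> A y) (at_right 0)"
  proof (rule LIM_zero_cancel, rule tendsto_norm_zero_cancel,
      rule tendsto_sandwich [OF _ _ tendsto_const id0])
    show "\<forall>\<^sub>F \<delta> in at_right 0. norm (f\<delta> \<delta> - A y) \<le> \<delta>"
      using small [OF assms(8)] by eventually_elim (rule noise)
  qed simp
  have "((\<lambda>\<delta>. A (v \<delta>) - f\<delta> \<delta>) \<longlongrightarrow> 0) (at_right 0)"
  proof (rule tendsto_norm_zero_cancel)
    have "((\<lambda>\<delta>. C * \<delta>) \<longlongrightarrow> 0) (at_right 0)" using tendsto_mult_right_zero [OF id0] .
    moreover have "\<forall>\<^sub>F \<delta> in at_right 0. C * \<delta> = norm (A (v \<delta>) - f\<delta> \<delta>)"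
      using small [OF assms(8)] by eventually_elim (simp add: res)
    ultimately show "((\<lambda>\<delta>. norm (A (v \<delta>) - f\<delta> \<delta>)) \<longlongrightarrow> 0) (at_right 0)"
      by (rule Lim_transform_eventually)
  qed
  from tendsto_add [OF this data_lim]
  have "((\<lambda>\<delta>. A (v \<delta>)) \<longlongrightarrow> A y) (at_right 0)" by simp
  moreover have "\<forall>\<^sub>F \<delta> in at_right 0. norm (v \<delta>) \<le> norm y"
    using small [OF assms(8)] by eventually_elim (rule v_le)
  ultimately have v_lim: "(v \<longlongrightarrow> y) (at_right 0)"
    using tendsto_minimal_norm_solution [OF A] assms(3) unfolding null_space_def by blast
  then show "((\<lambda>\<delta>. norm (u (\<alpha> \<delta>) \<delta> - y)) \<longlongrightarrow> 0) (at_right 0)"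
    unfolding v_def by (intro tendsto_norm_zero LIM_zero)

  have "y \<noteq> 0"
  proof
    assume "y = 0"
    moreover have mid: "\<delta>0 / 2 \<in> {0<..<\<delta>0}" using assms(8) by simp
    ultimately have "norm (f\<delta> (\<delta>0 / 2)) \<le> \<delta>0 / 2"
      using noise [OF mid] by (simp add: linear_0 bounded_linear.linear [OF A])
    moreover have "1 * (\<delta>0 / 2) \<le> C * (\<delta>0 / 2)"
      using assms(4,8) by (intro mult_right_mono) auto
    ultimately show False using assms(10) [OF mid] by linarith
  qed
  have bound: "\<forall>\<^sub>F \<delta> in at_right 0. \<alpha> \<delta> \<le> \<delta> * (C + norm (f\<delta> \<delta>))\<^sup>2 / (norm (v \<delta>))\<^sup>2"
  proof -
    have "\<forall>\<^sub>F \<delta> in at_right 0. v \<delta> \<noteq> 0"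
      by (rule tendsto_imp_eventually_ne [OF v_lim \<open>y \<noteq> 0\<close>])
    then show ?thesis
      using small [OF assms(8)] small [OF zero_less_one]
    proof eventually_elim
      case (elim \<delta>)
      have "(C\<^sup>2 - 1 - b) * \<delta>\<^sup>2 \<le> C\<^sup>2 * \<delta>\<^sup>2"
        using assms(6) by (intro mult_right_mono) auto
      then have "\<alpha> \<delta> * (norm (v \<delta>))\<^sup>2 \<le> \<delta> * (C + norm (f\<delta> \<delta>))\<^sup>2"
        using elim pos res near_v by (intro penalty_bound_by_shrinking [OF A]) auto
      then show ?case using elim(1) by (simp add: field_simps)
    qed
  qed
  show "(\<alpha> \<longlongrightarrow> 0) (at_right 0)"
  proof (rule tendsto_sandwich [OF _ bound tendsto_const])
    show "\<forall>\<^sub>F \<delta> in at_right 0. 0 \<le> \<alpha> \<delta>"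
      using small [OF assms(8)] by eventually_elim (simp add: pos less_imp_le)
    have "((\<lambda>\<delta>. \<delta> * (C + norm (f\<delta> \<delta>))\<^sup>2 / (norm (v \<delta>))\<^sup>2)
        \<longlongrightarrow> 0 * (C + norm (A y))\<^sup>2 / (norm y)\<^sup>2) (at_right 0)"
      by (intro tendsto_intros data_lim v_lim) (use \<open>y \<noteq> 0\<close> in simp)
    then show "((\<lambda>\<delta>. \<delta> * (C + norm (f\<delta> \<delta>))\<^sup>2 / (norm (v \<delta>))\<^sup>2) \<longlongrightarrow> 0) (at_right 0)"
      by simp
  qed
qed

end
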